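(* There is an algorithm which, given as input an explicitly represented ordered graph $(G,<)$ with $n$ vertices, decides in time $O(n)$ whether $K_3$ is an interval minor of $(G,<)$.
   Context: An ordered graph is a finite simple graph with a linear order on its vertices; explicit representation means a list of edges and the list of vertices sorted according to the order. $K_3$ is an interval minor of $(G,<)$ iff $V(G)$ can be partitioned into three nonempty intervals (sets of consecutive vertices) $I_1<I_2<I_3$ such that $G$ has an edge between $I_1$ and $I_2$, between $I_1$ and $I_3$, and between $I_2$ and $I_3$. *)

theory Defs
  imports Complex_Main "HOL-Library.Landau_Symbols"
begin

subsection \<open>Ordered graphs and the interval minor \<open>K\<^sub>3\<close>\<close>

text \<open>Vertices are natural numbers because they have to be stored in machine words; no
  relation is assumed between the numerical order and the order \<^term>\<open>r\<close> of the graph.\<close>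

definition ordered_graph :: "nat set \<Rightarrow> nat set set \<Rightarrow> nat rel \<Rightarrow> bool" where
  "ordered_graph V E r \<longleftrightarrow>
     finite V \<and> (\<forall>e\<in>E. \<exists>u\<in>V. \<exists>v\<in>V. u \<noteq> v \<and> e = {u, v}) \<and> linear_order_on V r"

definition order_interval :: "'a set \<Rightarrow> 'a rel \<Rightarrow> 'a set \<Rightarrow> bool" where
  "order_interval V r I \<longleftrightarrow>
     I \<subseteq> V \<and> (\<forall>x\<in>I. \<forall>z\<in>I. \<forall>y\<in>V. (x, y) \<in> r \<and> (y, z) \<in> r \<longrightarrow> y \<in> I)"

definition set_before :: "'a rel \<Rightarrow> 'a set \<Rightarrow> 'a set \<Rightarrow> bool" where
  "set_before r A B \<longleftrightarrow> (\<forall>a\<in>A. \<forall>b\<in>B. a \<noteq> b \<and> (a, b) \<in> r)"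

definition edge_between :: "'a set set \<Rightarrow> 'a set \<Rightarrow> 'a set \<Rightarrow> bool" where
  "edge_between E A B \<longleftrightarrow> (\<exists>a\<in>A. \<exists>b\<in>B. {a, b} \<in> E)"

definition K3_interval_minor :: "'a set \<Rightarrow> 'a set set \<Rightarrow> 'a rel \<Rightarrow> bool" where
  "K3_interval_minor V E r \<longleftrightarrow>
     (\<exists>I\<^sub>1 I\<^sub>2 I\<^sub>3.
        I\<^sub>1 \<noteq> {} \<and> I\<^sub>2 \<noteq> {} \<and> I\<^sub>3 \<noteq> {} \<and>
        I\<^sub>1 \<union> I\<^sub>2 \<union> I\<^sub>3 = V \<and> I\<^sub>1 \<inter> I\<^sub>2 = {} \<and> I\<^sub>1 \<inter> I\<^sub>3 = {} \<and> I\<^sub>2 \<inter> I\<^sub>3 = {} \<and>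
        order_interval V r I\<^sub>1 \<and> order_interval V r I\<^sub>2 \<and> order_interval V r I\<^sub>3 \<and>
        set_before r I\<^sub>1 I\<^sub>2 \<and> set_before r I\<^sub>1 I\<^sub>3 \<and> set_before r I\<^sub>2 I\<^sub>3 \<and>
        edge_between E I\<^sub>1 I\<^sub>2 \<and> edge_between E I\<^sub>1 I\<^sub>3 \<and> edge_between E I\<^sub>2 I\<^sub>3)"

text \<open>The edge list contains every edge exactly once, with its two ends in arbitrary order;
  the edges themselves come in arbitrary order.\<close>

definition explicit_representation ::
  "nat set \<Rightarrow> nat set set \<Rightarrow> nat rel \<Rightarrow> nat list \<Rightarrow> (nat \<times> nat) list \<Rightarrow> bool" where
  "explicit_representation V E r vs es \<longleftrightarrow>
     distinct vs \<and> set vs = V \<and> sorted_wrt (\<lambda>u v. (u, v) \<in> r) vs \<and>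
     distinct (map (\<lambda>(u, v). {u, v}) es) \<and> set (map (\<lambda>(u, v). {u, v}) es) = E"

subsection \<open>Unit-cost word RAM\<close>

text \<open>Programs are while programs over finitely many scalar registers and finitely many
  random-access arrays (a program text mentions only finitely many names). All cells hold
  words of \<open>w\<close> bits, represented as natural numbers below \<open>2 ^ w\<close>: addition
  and literals are reduced modulo \<open>2 ^ w\<close>, and subtraction is truncated at \<open>0\<close>.
  The program is independent of \<open>w\<close>. There is neither multiplication nor any other
  operation that is not constant-time on a word RAM, and the time charged is the number of
  elementary operations, i.e. the number of syntax nodes evaluated or executed.\<close>

datatype aexp =
    Lit nat
  | Var string
  | Elem string aexp
  | Plus aexp aexp
  | Minus aexp aexp

datatype bexp =
    Less aexp aexp
  | Eq aexp aexp
  | Not bexp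
  | And bexp bexp

datatype com =
    Skip
  | Assign string aexp
  | Store string aexp aexp
  | Seq com com
  | If bexp com com
  | While bexp com

record state =
  scalar :: "string \<Rightarrow> nat"
  array :: "string \<Rightarrow> nat \<Rightarrow> nat"

fun aval :: "nat \<Rightarrow> aexp \<Rightarrow> state \<Rightarrow> nat" where
  "aval w (Lit k) s = k mod 2 ^ w"
| "aval w (Var x) s = scalar s x"
| "aval w (Elem A a) s = array s A (aval w a s)"
| "aval w (Plus a b) s = (aval w a s + aval w b s) mod 2 ^ w"
| "aval w (Minus a b) s = aval w a s - aval w b s"

fun bval :: "nat \<Rightarrow> bexp \<Rightarrow> state \<Rightarrow> bool" where
  "bval w (Less a b) s \<longleftrightarrow> aval w a s < aval w b s"
| "bval w (Eq a b) s \<longleftrightarrow> aval w a s = aval w b s"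
| "bval w (Not b) s \<longleftrightarrow> \<not> bval w b s"
| "bval w (And b c) s \<longleftrightarrow> bval w b s \<and> bval w c s"

fun acost :: "aexp \<Rightarrow> nat" where
  "acost (Lit k) = 1"
| "acost (Var x) = 1"
| "acost (Elem A a) = acost a + 1"
| "acost (Plus a b) = acost a + acost b + 1"
| "acost (Minus a b) = acost a + acost b + 1"

fun bcost :: "bexp \<Rightarrow> nat" where
  "bcost (Less a b) = acost a + acost b + 1"
| "bcost (Eq a b) = acost a + acost b + 1"
| "bcost (Not b) = bcost b + 1"
| "bcost (And b c) = bcost b + bcost c + 1"

definition set_scalar :: "string \<Rightarrow> nat \<Rightarrow> state \<Rightarrow> state" where
  "set_scalar x k s = s\<lparr>scalar := (scalar s)(x := k)\<rparr>"

definition set_array :: "string \<Rightarrow> nat \<Rightarrow> nat \<Rightarrow> state \<Rightarrow> state" where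
  "set_array A i k s = s\<lparr>array := (array s)(A := (array s A)(i := k))\<rparr>"

text \<open>\<open>exec w P s t s'\<close>: with word length \<open>w\<close>, the program \<open>P\<close>
  started in state \<open>s\<close> halts in state \<open>s'\<close> after time \<open>t\<close>.\<close>

inductive exec :: "nat \<Rightarrow> com \<Rightarrow> state \<Rightarrow> nat \<Rightarrow> state \<Rightarrow> bool" for w where
  Skip: "exec w Skip s 1 s"
| Assign: "exec w (Assign x a) s (acost a + 1) (set_scalar x (aval w a s) s)"
| Store: "exec w (Store A i a) s (acost i + acost a + 1)
            (set_array A (aval w i s) (aval w a s) s)"
| Seq: "exec w P s t s' \<Longrightarrow> exec w Q s' u s'' \<Longrightarrow> exec w (Seq P Q) s (t + u + 1) s''"
| IfTrue: "bval w b s \<Longrightarrow> exec w P s t s' \<Longrightarrow> exec w (If b P Q) s (bcost b + t + 1) s'"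
| IfFalse: "\<not> bval w b s \<Longrightarrow> exec w Q s t s' \<Longrightarrow> exec w (If b P Q) s (bcost b + t + 1) s'"
| WhileFalse: "\<not> bval w b s \<Longrightarrow> exec w (While b P) s (bcost b + 1) s"
| WhileTrue: "bval w b s \<Longrightarrow> exec w P s t s' \<Longrightarrow> exec w (While b P) s' u s'' \<Longrightarrow>
            exec w (While b P) s (bcost b + t + u + 1) s''"

inductive_cases exec_SkipE: "exec w Skip s t s'"
  and exec_AssignE: "exec w (Assign x a) s t s'"
  and exec_StoreE: "exec w (Store A i a) s t s'"
  and exec_SeqE: "exec w (Seq P Q) s t s'"
  and exec_IfE: "exec w (If b P Q) s t s'"
  and exec_WhileE: "exec w (While b P) s t s'"

lemma exec_deterministic:
  "exec w P s t s' \<Longrightarrow> exec w P s u s'' \<Longrightarrow> u = t \<and> s'' = s'"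
proof (induction arbitrary: u s'' rule: exec.induct)
  case (Seq P s t s1 Q u1 s2)
  from Seq.prems obtain t' u' s1' where
    "exec w P s t' s1'" "exec w Q s1' u' s''" "u = t' + u' + 1"
    by (rule exec_SeqE) simp
  with Seq.IH show ?case by metis
next
  case (IfTrue b s P t s1 Q)
  from IfTrue.prems IfTrue.hyps(1) obtain t' where "exec w P s t' s''" "u = bcost b + t' + 1"
    by (auto elim: exec_IfE)
  with IfTrue.IH show ?case by metis
next
  case (IfFalse b s Q t s1 P)
  from IfFalse.prems IfFalse.hyps(1) obtain t' where "exec w Q s t' s''" "u = bcost b + t' + 1"
    by (auto elim: exec_IfE)
  with IfFalse.IH show ?case by metis
next
  case (WhileTrue b s P t s1 u1 s2)
  from WhileTrue.prems WhileTrue.hyps(1) obtain t' u' s1' where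
    "exec w P s t' s1'" "exec w (While b P) s1' u' s''" "u = bcost b + t' + u' + 1"
    by (auto elim: exec_WhileE)
  with WhileTrue.IH show ?case by metis
qed (auto elim: exec_SkipE exec_AssignE exec_StoreE exec_WhileE)

text \<open>Only the input is loaded; all other cells are \<open>0\<close>. Loading takes no
  time, so a program need not read the whole edge list.\<close>

definition array_of :: "nat list \<Rightarrow> nat \<Rightarrow> nat" where
  "array_of xs i = (if i < length xs then xs ! i else 0)"

definition initial_state :: "nat list \<Rightarrow> (nat \<times> nat) list \<Rightarrow> state" where
  "initial_state vs es =
     \<lparr>scalar = (\<lambda>_. 0)(''n'' := length vs, ''m'' := length es),
      array = (\<lambda>_ _. 0)(''vertex'' := array_of vs,
                        ''end1'' := array_of (map fst es),
                        ''end2'' := array_of (map snd es))\<rparr>"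

text \<open>Every vertex name fits into a word, and so do the lengths of the input lists, up to a
  constant factor \<open>c\<close> that may depend on the program but not on the input. If the vertices
  are named by numbers polynomial in their count, words of \<open>O(log n)\<close> bits suffice.\<close>

definition word_length_suffices :: "nat \<Rightarrow> nat \<Rightarrow> nat list \<Rightarrow> (nat \<times> nat) list \<Rightarrow> bool" where
  "word_length_suffices c w vs es \<longleftrightarrow>
     (\<forall>v\<in>set vs. v < 2 ^ w) \<and> c * (length vs + length es + 1) < 2 ^ w"

end

theory Submission
  imports Defs
begin

text \<open>Number the vertices by their positions and write an edge as \<open>(x, y)\<close> with \<open>x < y\<close>. An edge that is
  neither the shortest at its left end nor the shortest at its right end lies in a triangle minor,
  so more than \<open>2n\<close> edges force one, and otherwise the whole edge list can be read. For the last
  position \<open>a\<close> of the first interval, let \<open>p\<close> be the smallest right end of an edge crossing \<open>a\<close> and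
  \<open>R\<close> the largest right end of an edge starting at or before \<open>a\<close>. A triangle minor with this \<open>a\<close>
  exists iff \<open>p < R\<close> and some edge starting after \<open>a\<close> either crosses \<open>p\<close> or starts strictly
  between \<open>p\<close> and \<open>R\<close>. For all \<open>a\<close> together these tests take linear time by prefix maxima and
  pointer jumping.\<close>

subsection \<open>Triangles in terms of positions\<close>

text \<open>Positions are counted from 1, so the default 0 for an empty set can stand for "no such
  position".\<close>

definition max0 :: "nat set \<Rightarrow> nat" where
  "max0 A = Max (insert 0 A)"

lemma less_max0_iff: "finite A \<Longrightarrow> k < max0 A \<longleftrightarrow> (\<exists>x\<in>A. k < x)"
  by (simp add: max0_def Max_gr_iff)

lemma max0_le_iff: "finite A \<Longrightarrow> max0 A \<le> k \<longleftrightarrow> (\<forall>x\<in>A. x \<le> k)"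
  by (simp add: max0_def)

lemma max0_ge: "finite A \<Longrightarrow> x \<in> A \<Longrightarrow> x \<le> max0 A"
  by (simp add: max0_def)

lemma max0_in: "finite A \<Longrightarrow> max0 A \<noteq> 0 \<Longrightarrow> max0 A \<in> A"
  using Max_in[of "insert 0 A"] by (auto simp: max0_def)

lemma max0_empty [simp]: "max0 {} = 0"
  by (simp add: max0_def)

lemma max0_insert: "finite A \<Longrightarrow> max0 (insert x A) = max x (max0 A)"
  by (simp add: max0_def insert_commute[of 0 x] Max_insert[of "insert 0 A"] del: Max_insert)

lemma max0_eqI: "finite A \<Longrightarrow> (\<And>x. x \<in> A \<Longrightarrow> x \<le> m) \<Longrightarrow> m = 0 \<or> m \<in> A \<Longrightarrow> max0 A = m"
  by (metis le_antisym max0_ge max0_le_iff le_zero_eq)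

definition position_edges :: "nat \<Rightarrow> (nat \<times> nat) set \<Rightarrow> bool" where
  "position_edges n S \<longleftrightarrow> (\<forall>(x, y)\<in>S. 1 \<le> x \<and> x < y \<and> y \<le> n)"

text \<open>Here \<open>a\<close> is the last position of the first interval and \<open>b\<close> the first position of the
  third one.\<close>

definition K3_positions :: "(nat \<times> nat) set \<Rightarrow> bool" where
  "K3_positions S \<longleftrightarrow> (\<exists>a b.
     (\<exists>(x, y)\<in>S. x \<le> a \<and> a < y \<and> y < b) \<and>
     (\<exists>(x, y)\<in>S. a < x \<and> x < b \<and> b \<le> y) \<and>
     (\<exists>(x, y)\<in>S. x \<le> a \<and> b \<le> y))"

lemma K3_positionsI:
  assumes "(x1, y1) \<in> S" "x1 \<le> a" "a < y1" "y1 < b"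
    and "(x2, y2) \<in> S" "a < x2" "x2 < b" "b \<le> y2"
    and "(x3, y3) \<in> S" "x3 \<le> a" "b \<le> y3"
  shows "K3_positions S"
  unfolding K3_positions_def by (rule exI[of _ a], rule exI[of _ b]) (use assms in fast)

lemma K3_positionsE:
  assumes "K3_positions S"
  obtains a b x1 y1 x2 y2 x3 y3
  where "(x1, y1) \<in> S" "x1 \<le> a" "a < y1" "y1 < b"
    and "(x2, y2) \<in> S" "a < x2" "x2 < b" "b \<le> y2"
    and "(x3, y3) \<in> S" "x3 \<le> a" "b \<le> y3"
  using assms unfolding K3_positions_def by (elim exE conjE bexE) (auto split: prod.splits)

lemma position_edges_finite: "position_edges n S \<Longrightarrow> finite S"
  by (rule finite_subset[of _ "{..n} \<times> {..n}"]) (auto simp: position_edges_def)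

text \<open>If \<open>(x, y)\<close> is the shortest edge neither at \<open>x\<close> nor at \<open>y\<close>, then it forms a triangle with
  a shorter edge at \<open>x\<close> and a shorter edge at \<open>y\<close>.\<close>

lemma K3_positions_if_many_edges:
  assumes S: "position_edges n S" and card: "2 * n < card S"
  shows "K3_positions S"
proof (rule ccontr)
  assume no: "\<not> K3_positions S"
  have fin: "finite S"
    using S by (rule position_edges_finite)
  \<comment> \<open>Wherever such an edge exists, \<open>f x\<close> is the shortest edge starting
    at \<open>x\<close> and \<open>g y\<close> the shortest edge ending at \<open>y\<close>. The two
    images have at most \<open>2 * n\<close> elements together.\<close>
  define f where "f x = (x, Min {y. (x, y) \<in> S})" for x
  define g where "g y = (Max {x. (x, y) \<in> S}, y)" for y
  have finR: "finite {y. (x, y) \<in> S}" for x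
    by (rule finite_subset[OF _ finite_imageI[OF fin, of snd]]) force
  have finL: "finite {x. (x, y) \<in> S}" for y
    by (rule finite_subset[OF _ finite_imageI[OF fin, of fst]]) force
  have "S \<subseteq> f ` {1..n} \<union> g ` {1..n}"
  proof (rule subsetI, clarify)
    fix x y assume xy: "(x, y) \<in> S" and ng: "(x, y) \<notin> g ` {1..n}"
    have bounds: "1 \<le> x" "x < y" "y \<le> n"
      using S xy by (auto simp: position_edges_def)
    show "(x, y) \<in> f ` {1..n}"
    proof (rule ccontr)
      assume nf: "(x, y) \<notin> f ` {1..n}"
      define y' where "y' = Min {y. (x, y) \<in> S}"
      define x' where "x' = Max {x. (x, y) \<in> S}"
      have "(x, y') \<in> S"
        using Min_in[OF finR, of x] xy by (auto simp: y'_def)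
      moreover have "y' \<le> y"
        using Min_le[OF finR, of y x] xy by (auto simp: y'_def)
      moreover have "y' \<noteq> y"
        using nf bounds by (auto simp: f_def y'_def image_iff)
      moreover have "(x', y) \<in> S"
        using Max_in[OF finL, of y] xy by (auto simp: x'_def)
      moreover have "x \<le> x'"
        using Max_ge[OF finL, of x y] xy by (auto simp: x'_def)
      moreover have "x' \<noteq> x"
        using ng bounds by (auto simp: g_def x'_def image_iff)
      moreover have "x < y'" "x' < y"
        using S \<open>(x, y') \<in> S\<close> \<open>(x', y) \<in> S\<close> by (auto simp: position_edges_def)
      \<comment> \<open>Cut at \<open>a = x\<close> and \<open>b = y\<close>: \<open>(x, y')\<close>
        ends before \<open>b\<close>, \<open>(x', y)\<close> starts after \<open>a\<close>, and
        \<open>(x, y)\<close> spans both cuts.\<close>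
      ultimately have "K3_positions S"
        using xy K3_positionsI[of x y' S x y x' y x y] by simp
      with no show False ..
    qed
  qed
  then have "card S \<le> card (f ` {1..n} \<union> g ` {1..n})"
    by (intro card_mono) auto
  also have "\<dots> \<le> card (f ` {1..n}) + card (g ` {1..n})"
    by (rule card_Un_le)
  also have "\<dots> \<le> n + n"
    using card_image_le[of "{1..n}" f] card_image_le[of "{1..n}" g] by simp
  finally show False
    using card by simp
qed

section \<open>Extremal edges around a position\<close>

definition farthest :: "(nat \<times> nat) set \<Rightarrow> nat \<Rightarrow> nat" where
  "farthest S x = max0 {y. (x, y) \<in> S}"

text \<open>Reversing the positions turns a least right end into a greatest left end, so the single
  notion \<open>latest_cover\<close> serves both directions.\<close>

definition mirror :: "nat \<Rightarrow> nat \<times> nat \<Rightarrow> nat \<times> nat" where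
  "mirror n = (\<lambda>(x, y). (n + 1 - y, n + 1 - x))"

definition latest_cover :: "(nat \<Rightarrow> nat) \<Rightarrow> nat \<Rightarrow> nat" where
  "latest_cover f b = max0 {x. x < b \<and> b \<le> f x}"

definition latest_start :: "(nat \<Rightarrow> nat) \<Rightarrow> nat \<Rightarrow> nat" where
  "latest_start f b = max0 {x. x < b \<and> 0 < f x}"

definition prefix_max :: "(nat \<Rightarrow> nat) \<Rightarrow> nat \<Rightarrow> nat" where
  "prefix_max f a = max0 (f ` {..a})"

text \<open>The least right end of an edge crossing \<open>a\<close>, obtained as a latest cover in
  the mirrored graph. If no edge crosses \<open>a\<close>, the cover is 0 and the value
  \<open>n + 1\<close> lies beyond every right end.\<close>

definition next_end :: "nat \<Rightarrow> (nat \<times> nat) set \<Rightarrow> nat \<Rightarrow> nat" where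
  "next_end n S a = n + 1 - latest_cover (farthest (mirror n ` S)) (n + 1 - a)"

lemma finite_neighbours: "finite S \<Longrightarrow> finite {y. (x, y) \<in> S}"
  by (rule finite_subset[of _ "snd ` S"]) force+

lemma less_farthest_iff: "finite S \<Longrightarrow> k < farthest S x \<longleftrightarrow> (\<exists>y. (x, y) \<in> S \<and> k < y)"
  by (simp add: farthest_def less_max0_iff finite_neighbours)

lemma farthest_edge: "finite S \<Longrightarrow> farthest S x \<noteq> 0 \<Longrightarrow> (x, farthest S x) \<in> S"
  using max0_in[OF finite_neighbours, of S x] by (simp add: farthest_def)

text \<open>Reading one edge changes a single cell, so the table can be built in constant time per
  edge.\<close>

lemma farthest_insert:
  "finite S \<Longrightarrow> farthest (insert (u, v) S) = (farthest S)(u := max v (farthest S u))"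
proof
  fix x assume "finite S"
  moreover have "{y. (x, y) \<in> insert (u, v) S} =
      (if x = u then insert v {y. (x, y) \<in> S} else {y. (x, y) \<in> S})"
    by auto
  ultimately show "farthest (insert (u, v) S) x = ((farthest S)(u := max v (farthest S u))) x"
    by (auto simp: farthest_def max0_insert finite_neighbours)
qed

lemma farthest_empty: "farthest {} x = 0"
  by (simp add: farthest_def)

lemma farthest_le: "position_edges n S \<Longrightarrow> farthest S x \<le> n"
  by (rule ccontr) (auto simp: not_le less_farthest_iff position_edges_finite position_edges_def)

lemma farthest_0: "position_edges n S \<Longrightarrow> farthest S 0 = 0"
  using farthest_edge[OF position_edges_finite, of n S 0] by (auto simp: position_edges_def)

lemma latest_cover_less: "0 < b \<Longrightarrow> latest_cover f b < b"
  unfolding latest_cover_def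
  using max0_in[of "{x. x < b \<and> b \<le> f x}"] by fastforce

lemma latest_start_Suc:
  "latest_start f (Suc b) = (if 0 < f b then b else latest_start f b)"
proof (cases "0 < f b")
  case True
  then show ?thesis
    by (auto simp: latest_start_def intro!: max0_eqI)
next
  case False
  then have "{x. x < Suc b \<and> 0 < f x} = {x. x < b \<and> 0 < f x}"
    by (auto simp: less_Suc_eq)
  with False show ?thesis
    by (simp add: latest_start_def)
qed

lemma prefix_max_Suc: "prefix_max f (Suc a) = max (f (Suc a)) (prefix_max f a)"
  by (simp add: prefix_max_def atMost_Suc max0_insert)

lemma less_prefix_max_iff: "k < prefix_max f a \<longleftrightarrow> (\<exists>x\<le>a. k < f x)"
  unfolding prefix_max_def by (subst less_max0_iff) auto

text \<open>The mirrored edge starts at \<open>n + 1 - y\<close> and covers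
  \<open>n + 1 - a\<close>, so it competes in the maximum behind
  \<open>latest_cover\<close>.\<close>

lemma next_end_le:
  assumes S: "position_edges n S" and "(x, y) \<in> S" "x \<le> a" "a < y"
  shows "next_end n S a \<le> y"
proof -
  have S': "finite (mirror n ` S)"
    using S by (simp add: position_edges_finite)
  have b: "1 \<le> x" "x < y" "y \<le> n"
    using assms by (auto simp: position_edges_def)
  have "(n + 1 - y, n + 1 - x) \<in> mirror n ` S"
    using \<open>(x, y) \<in> S\<close> by (force simp: mirror_def)
  then have "n - a < farthest (mirror n ` S) (n + 1 - y)"
    unfolding less_farthest_iff[OF S'] using assms b by (intro exI[of _ "n + 1 - x"]) auto
  then have "n + 1 - y \<le> latest_cover (farthest (mirror n ` S)) (n + 1 - a)"
    unfolding latest_cover_def using assms b by (intro max0_ge) auto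
  then show ?thesis
    using b by (simp add: next_end_def)
qed

text \<open>A value of at most \<open>n\<close> means that the maximum is not the default 0. Hence
  it is attained, and mirroring its edge back gives the required one.\<close>

lemma next_end_edge:
  assumes S: "position_edges n S" and "next_end n S a \<le> n" and a: "a \<le> n"
  obtains x where "(x, next_end n S a) \<in> S" "x \<le> a" "a < next_end n S a"
proof -
  let ?f = "farthest (mirror n ` S)"
  define z where "z = latest_cover ?f (n + 1 - a)"
  have S': "finite (mirror n ` S)"
    using S by (simp add: position_edges_finite)
  have "z \<noteq> 0"
    using assms by (auto simp: next_end_def z_def)
  then have "z < n + 1 - a \<and> n + 1 - a \<le> ?f z"
    unfolding z_def latest_cover_def
    using max0_in[of "{x. x < n + 1 - a \<and> n + 1 - a \<le> ?f x}"] by auto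
  then have z: "z < n + 1 - a" "n - a < ?f z"
    using a by auto
  then obtain y' where "(z, y') \<in> mirror n ` S" "n - a < y'"
    unfolding less_farthest_iff[OF S'] by auto
  then obtain x y where xy: "(x, y) \<in> S" "z = n + 1 - y" "n - a < n + 1 - x"
    by (auto simp: mirror_def)
  have b: "1 \<le> x" "x < y" "y \<le> n"
    using S xy by (auto simp: position_edges_def)
  have "next_end n S a = y"
    using xy b unfolding next_end_def z_def[symmetric] by simp
  with that[of x] show thesis
    using xy b z a by auto
qed

text \<open>Given \<open>a\<close>, the edge from the first to the second interval may be taken to end at
  \<open>p = next_end n S a\<close>. The edge from the second to the third interval either crosses \<open>p\<close>, so that
  \<open>b = p + 1\<close> works, or starts after \<open>p\<close>, in which case only its left end matters.\<close>

lemma K3_positions_iff: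
  assumes S: "position_edges n S"
  defines "f \<equiv> farthest S"
  shows "K3_positions S \<longleftrightarrow> (\<exists>a. 1 \<le> a \<and> a \<le> n \<and> next_end n S a < prefix_max f a \<and>
    (a < latest_cover f (next_end n S a + 1) \<or> next_end n S a < latest_start f (prefix_max f a)))"
    (is "_ \<longleftrightarrow> (\<exists>a. ?Q a)")
proof
  have fin: "finite S"
    using S by (rule position_edges_finite)
  have cover: "k < latest_cover f b \<longleftrightarrow> (\<exists>x. x < b \<and> b \<le> f x \<and> k < x)" for k b
    unfolding latest_cover_def by (subst less_max0_iff) auto
  have start: "k < latest_start f b \<longleftrightarrow> (\<exists>x. x < b \<and> 0 < f x \<and> k < x)" for k b
    unfolding latest_start_def by (subst less_max0_iff) auto
  {
    assume "K3_positions S"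
    then obtain a b x1 y1 x2 y2 x3 y3 where
      e1: "(x1, y1) \<in> S" "x1 \<le> a" "a < y1" "y1 < b" and
      e2: "(x2, y2) \<in> S" "a < x2" "x2 < b" "b \<le> y2" and
      e3: "(x3, y3) \<in> S" "x3 \<le> a" "b \<le> y3"
      by (rule K3_positionsE)
    let ?p = "next_end n S a"
    have p: "?p \<le> y1"
      using S e1 by (intro next_end_le)
    have a: "1 \<le> a" "a \<le> n"
      using S e1 by (auto simp: position_edges_def)
    \<comment> \<open>The rule for \<open>farthest\<close> is about strict inequality, so it is used
      at \<open>b - 1\<close>; \<open>b\<close> is positive because \<open>y1 < b\<close>.\<close>
    have "b \<le> f x3"
      using e3 fin less_farthest_iff[of S "b - 1" x3] e1(4) by (fastforce simp: f_def)
    then have R: "b \<le> prefix_max f a"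
      using e3 e1(4) less_prefix_max_iff[of "b - 1" f a] by fastforce
    have f2: "b \<le> f x2"
      using e2 fin less_farthest_iff[of S "b - 1" x2] e1(4) by (fastforce simp: f_def)
    have "a < latest_cover f (?p + 1) \<or> ?p < latest_start f (prefix_max f a)"
    proof (cases "x2 \<le> ?p")
      case True
      then show ?thesis
        unfolding cover using e1 e2 f2 p by (intro disjI1 exI[of _ x2]) simp
    next
      case False
      then show ?thesis
        unfolding start using e1 e2 f2 R by (intro disjI2 exI[of _ x2]) simp
    qed
    then show "\<exists>a. ?Q a"
      using a p R e1 by auto
  next
    assume "\<exists>a. ?Q a"
    then obtain a where a: "1 \<le> a" "a \<le> n" and pR: "next_end n S a < prefix_max f a" and
      alt: "a < latest_cover f (next_end n S a + 1) \<or>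
        next_end n S a < latest_start f (prefix_max f a)"
      by blast
    let ?p = "next_end n S a"
    obtain x3 where x3: "x3 \<le> a" "prefix_max f a \<le> f x3"
      using less_prefix_max_iff[of "prefix_max f a - 1" f a] pR by force
    have fx3: "(x3, f x3) \<in> S"
      using x3 pR farthest_edge[OF fin, of x3] by (simp add: f_def)
    then have "f x3 \<le> n"
      using S by (auto simp: position_edges_def)
    then have pn: "?p \<le> n"
      using pR x3 by simp
    obtain x1 where x1: "(x1, ?p) \<in> S" "x1 \<le> a" "a < ?p"
      using next_end_edge[OF S pn a(2)] .
    from alt show "K3_positions S"
    proof
      assume "a < latest_cover f (?p + 1)"
      then obtain x2 where x2: "x2 \<le> ?p" "?p < f x2" "a < x2"
        unfolding cover using less_Suc_eq_le Suc_le_eq by auto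
      then obtain y2 where "(x2, y2) \<in> S" "?p < y2"
        using fin by (auto simp: f_def less_farthest_iff)
      then show ?thesis
        using x1 x2 x3 fx3 pR K3_positionsI[of x1 ?p S a "?p + 1" x2 y2 x3 "f x3"] by simp
    next
      assume "?p < latest_start f (prefix_max f a)"
      then obtain x2 where x2: "x2 < prefix_max f a" "0 < f x2" "?p < x2"
        unfolding start by blast
      then obtain y2 where "(x2, y2) \<in> S"
        using fin by (auto simp: f_def less_farthest_iff)
      moreover from this have "x2 < y2"
        using S by (auto simp: position_edges_def)
      \<comment> \<open>Here \<open>b = x2 + 1\<close>: every edge leaving \<open>x2\<close> to the
        right reaches it, and so does the longest edge at \<open>x3\<close>, because
        \<open>x2 < prefix_max f a\<close>.\<close>
      ultimately show ?thesis
        using x1 x2 x3 fx3 pR K3_positionsI[of x1 ?p S a "x2 + 1" x2 y2 x3 "f x3"] by simp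
    qed
  }
qed

section \<open>Translation between the ordered graph and positions\<close>

definition position_edge :: "(nat \<Rightarrow> nat) \<Rightarrow> nat \<times> nat \<Rightarrow> nat \<times> nat" where
  "position_edge p = (\<lambda>(u, v). (min (p u) (p v), max (p u) (p v)))"

text \<open>Only the values of \<open>p\<close> on listed vertices are fixed, so \<open>p\<close>
  may be a function given by description as well as an array filled by the program.\<close>

locale represented_graph =
  fixes V :: "nat set" and E :: "nat set set" and r :: "nat rel"
    and vs :: "nat list" and es :: "(nat \<times> nat) list" and p :: "nat \<Rightarrow> nat"
  assumes graph: "ordered_graph V E r"
    and repr: "explicit_representation V E r vs es"
    and pos: "\<And>i. i < length vs \<Longrightarrow> p (vs ! i) = Suc i"
begin

abbreviation S :: "(nat \<times> nat) set" where
  "S \<equiv> position_edge p ` set es"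

lemma set_vs: "set vs = V" and distinct_vs: "distinct vs"
  and edge_set: "E = (\<lambda>(u, v). {u, v}) ` set es"
  using repr by (auto simp: explicit_representation_def)

lemma pos_bounds: "v \<in> V \<Longrightarrow> 1 \<le> p v \<and> p v \<le> length vs"
  using pos by (auto simp: in_set_conv_nth simp flip: set_vs)

lemma pos_inj: "u \<in> V \<Longrightarrow> v \<in> V \<Longrightarrow> p u = p v \<longleftrightarrow> u = v"
  using pos by (auto simp: in_set_conv_nth simp flip: set_vs)

text \<open>Sortedness of \<open>vs\<close> turns a smaller position into \<open>r\<close>.
  Conversely, if the positions were the other way round, antisymmetry would make the vertices
  equal.\<close>

lemma pos_less_iff:
  assumes "u \<in> V" "v \<in> V"
  shows "p u < p v \<longleftrightarrow> u \<noteq> v \<and> (u, v) \<in> r"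
proof -
  have lin: "linear_order_on V r"
    using graph by (simp add: ordered_graph_def)
  have less: "(x, y) \<in> r" if "x \<in> V" "y \<in> V" "p x < p y" for x y
    using that repr pos
    by (auto simp: explicit_representation_def in_set_conv_nth sorted_wrt_iff_nth_less
        simp flip: set_vs)
  have "antisym r"
    using lin by (simp add: linear_order_on_def partial_order_on_def)
  then show ?thesis
    using less[OF assms] less[OF assms(2,1)] pos_inj[OF assms]
    by (metis antisymD linorder_neqE_nat less_irrefl)
qed

lemma edge_in_V: "(u, v) \<in> set es \<Longrightarrow> u \<in> V \<and> v \<in> V \<and> u \<noteq> v"
proof -
  assume "(u, v) \<in> set es"
  then have "{u, v} \<in> E"
    by (force simp: edge_set)
  then obtain x y where "x \<in> V" "y \<in> V" "x \<noteq> y" "{u, v} = {x, y}"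
    using graph by (fastforce simp: ordered_graph_def)
  then show ?thesis
    by (auto simp: doubleton_eq_iff)
qed

lemma position_edges_S: "position_edges (length vs) S"
proof -
  have "1 \<le> min (p u) (p v) \<and> min (p u) (p v) < max (p u) (p v) \<and> max (p u) (p v) \<le> length vs"
    if "(u, v) \<in> set es" for u v
    using edge_in_V[OF that] pos_bounds[of u] pos_bounds[of v] pos_inj[of u v] by auto
  then show ?thesis
    by (auto simp: position_edges_def position_edge_def)
qed

lemma S_iff:
  assumes "u \<in> V" "v \<in> V"
  shows "(p u, p v) \<in> S \<longleftrightarrow> {u, v} \<in> E \<and> p u < p v"
proof
  assume "(p u, p v) \<in> S"
  then obtain x y where xy: "(x, y) \<in> set es" "p u = min (p x) (p y)" "p v = max (p x) (p y)"
    by (auto simp: position_edge_def)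
  have "{x, y} = {u, v}"
    using xy(2,3) edge_in_V[OF xy(1)] assms pos_inj
    by (auto simp: min_def max_def split: if_splits)
  moreover have "{x, y} \<in> E"
    using xy(1) by (force simp: edge_set)
  ultimately show "{u, v} \<in> E \<and> p u < p v"
    using xy edge_in_V[OF xy(1)] pos_inj[of x y] by auto
next
  assume *: "{u, v} \<in> E \<and> p u < p v"
  then obtain x y where xy: "(x, y) \<in> set es" "{u, v} = {x, y}"
    by (auto simp: edge_set)
  then have "position_edge p (x, y) = (p u, p v)"
    using * by (auto simp: position_edge_def doubleton_eq_iff)
  then show "(p u, p v) \<in> S"
    using xy by force
qed

lemma S_obtain:
  assumes "(x, y) \<in> S"
  obtains u v where "u \<in> V" "v \<in> V" "x = p u" "y = p v" "{u, v} \<in> E"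
proof -
  obtain u v where uv: "(u, v) \<in> set es" "x = min (p u) (p v)" "y = max (p u) (p v)"
    using assms by (auto simp: position_edge_def)
  have "{u, v} \<in> E"
    using uv(1) by (force simp: edge_set)
  with that[of u v] that[of v u] uv edge_in_V[OF uv(1)] show thesis
    by (auto simp: min_def max_def insert_commute split: if_splits)
qed

text \<open>Two positions determine the unordered edge, and the list names every edge once. So the
  stored list length alone decides whether there are too many edges.\<close>

lemma card_S: "card S = length es"
proof -
  have "inj_on (position_edge p) (set es)"
  proof (rule inj_onI)
    fix e e' assume e: "e \<in> set es" "e' \<in> set es" and eq: "position_edge p e = position_edge p e'"
    obtain u v u' v' where uv: "e = (u, v)" "e' = (u', v')"
      by fastforce
    have "{u, v} = {u', v'}"
      using eq uv e edge_in_V[of u v] edge_in_V[of u' v']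
        pos_inj[of u u'] pos_inj[of u v'] pos_inj[of v u'] pos_inj[of v v']
      by (simp add: position_edge_def min_def max_def split: if_splits)
        (simp_all add: insert_commute)
    moreover have "inj_on (\<lambda>(u, v). {u, v}) (set es)"
      using repr by (simp add: explicit_representation_def distinct_map)
    ultimately show "e = e'"
      using e uv inj_onD[of "\<lambda>(u, v). {u, v}" "set es" e e'] by simp
  qed
  moreover have "distinct es"
    using repr by (simp add: explicit_representation_def distinct_map)
  ultimately show ?thesis
    by (simp add: card_image distinct_card)
qed

lemma K3_interval_minor_imp_positions:
  assumes "K3_interval_minor V E r"
  shows "K3_positions S"
proof -
  obtain I1 I2 I3 where I: "I1 \<union> I2 \<union> I3 = V" and
    before: "set_before r I1 I2" "set_before r I1 I3" "set_before r I2 I3" and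
    e: "edge_between E I1 I2" "edge_between E I1 I3" "edge_between E I2 I3"
    using assms unfolding K3_interval_minor_def by blast
  obtain u1 v1 u2 v2 u3 v3 where
    uv: "u1 \<in> I1" "v1 \<in> I2" "{u1, v1} \<in> E" "u2 \<in> I2" "v2 \<in> I3" "{u2, v2} \<in> E"
      "u3 \<in> I1" "v3 \<in> I3" "{u3, v3} \<in> E"
    using e unfolding edge_between_def by blast
  have sub: "I1 \<subseteq> V" "I2 \<subseteq> V" "I3 \<subseteq> V"
    using I by auto
  have fin: "finite I1" "finite I3"
    using sub graph finite_subset by (auto simp: ordered_graph_def)
  have less: "p x < p y" if "set_before r A B" "x \<in> A" "y \<in> B" "A \<subseteq> V" "B \<subseteq> V" for A B x y
    using that pos_less_iff[of x y] by (auto simp: set_before_def)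
  \<comment> \<open>The cuts are the last position of \<open>I1\<close> and the first of
    \<open>I3\<close>; both sets are nonempty since they contain ends of edges.\<close>
  define a where "a = Max (p ` I1)"
  define b where "b = Min (p ` I3)"
  have "a \<in> p ` I1" "b \<in> p ` I3"
    unfolding a_def b_def using uv fin by (intro Max_in Min_in; auto)+
  then obtain ua vb where ab: "ua \<in> I1" "a = p ua" "vb \<in> I3" "b = p vb"
    by auto
  have le: "x \<in> I1 \<Longrightarrow> p x \<le> a" "x \<in> I3 \<Longrightarrow> b \<le> p x" for x
    using fin by (auto simp: a_def b_def)
  have mid: "a < p x \<and> p x < b" if "x \<in> I2" for x
    using less[OF before(1) ab(1) that] less[OF before(3) that ab(3)] sub ab by simp
  have "p u1 < p v1" "p u2 < p v2" "p u3 < p v3"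
    using less[OF before(1)] less[OF before(2)] less[OF before(3)] uv sub by simp_all
  then have "(p u1, p v1) \<in> S" "(p u2, p v2) \<in> S" "(p u3, p v3) \<in> S"
    using uv sub S_iff[of u1 v1] S_iff[of u2 v2] S_iff[of u3 v3] by (simp_all add: subsetD)
  then show ?thesis
    using uv le mid by (intro K3_positionsI[of "p u1" "p v1" S a b "p u2" "p v2" "p u3" "p v3"]) auto
qed

lemma K3_positions_imp_interval_minor:
  assumes "K3_positions S"
  shows "K3_interval_minor V E r"
proof -
  obtain a b x1 y1 x2 y2 x3 y3 where
    e1: "(x1, y1) \<in> S" "x1 \<le> a" "a < y1" "y1 < b" and
    e2: "(x2, y2) \<in> S" "a < x2" "x2 < b" "b \<le> y2" and
    e3: "(x3, y3) \<in> S" "x3 \<le> a" "b \<le> y3"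
    using assms by (rule K3_positionsE)
  \<comment> \<open>Half-open ranges of positions: cut at 0, \<open>Suc a\<close>, \<open>b\<close>
    and \<open>h\<close>, they are disjoint and exhaust \<open>V\<close>, as \<open>h\<close>
    exceeds all positions.\<close>
  define I where "I l h = {v \<in> V. l \<le> p v \<and> p v < h}" for l h
  define h where "h = Suc (length vs)"
  have order: "p x \<le> p y" if "(x, y) \<in> r" "x \<in> V" "y \<in> V" for x y
    using that pos_less_iff[of x y] by (cases "x = y") auto
  have interval: "order_interval V r (I l h)" for l h
    unfolding order_interval_def I_def using order by (blast intro: order_trans le_less_trans)
  have before: "set_before r (I l h) (I l' h')" if "h \<le> l'" for l h l' h'
    unfolding set_before_def I_def using pos_less_iff that
    by (metis (mono_tags, lifting) less_le_trans mem_Collect_eq)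
  have bound: "p v < h" if "v \<in> V" for v
    using pos_bounds[OF that] by (simp add: h_def)
  have edge: "edge_between E (I l k) (I l' k')"
    if "(x, y) \<in> S" "l \<le> x" "x < k" "l' \<le> y" "y < k'" for x y l k l' k'
    using that by (elim S_obtain) (auto simp: edge_between_def I_def)
  have nonempty: "I l k \<noteq> {}" "I l' k' \<noteq> {}" if "edge_between E (I l k) (I l' k')" for l k l' k'
    using that by (auto simp: edge_between_def)
  have yh: "y < h" if "(x, y) \<in> S" for x y
    using that position_edges_S by (auto simp: position_edges_def h_def)
  have edges: "edge_between E (I 0 (Suc a)) (I (Suc a) b)" "edge_between E (I (Suc a) b) (I b h)"
    "edge_between E (I 0 (Suc a)) (I b h)"
    using edge[OF e1(1)] edge[OF e2(1)] edge[OF e3(1)] e1 e2 e3 yh by auto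
  have "Suc a \<le> b"
    using e1 by simp
  then have "I 0 (Suc a) \<union> I (Suc a) b \<union> I b h = V"
    "I 0 (Suc a) \<inter> I (Suc a) b = {}" "I 0 (Suc a) \<inter> I b h = {}" "I (Suc a) b \<inter> I b h = {}"
    using bound by (auto simp: I_def)
  moreover have "set_before r (I 0 (Suc a)) (I (Suc a) b)" "set_before r (I 0 (Suc a)) (I b h)"
    "set_before r (I (Suc a) b) (I b h)"
    using before \<open>Suc a \<le> b\<close> by simp_all
  ultimately show ?thesis
    unfolding K3_interval_minor_def
    using edges nonempty[OF edges(1)] nonempty[OF edges(2)] interval by blast
qed

lemma K3_interval_minor_iff: "K3_interval_minor V E r \<longleftrightarrow> K3_positions S"
  using K3_interval_minor_imp_positions K3_positions_imp_interval_minor by blast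

end

subsection \<open>A time-aware program logic\<close>

text \<open>The time bound when every loop makes at most \<open>k\<close> iterations.\<close>

fun time_bound :: "nat \<Rightarrow> com \<Rightarrow> nat" where
  "time_bound k Skip = 1"
| "time_bound k (Assign x a) = acost a + 1"
| "time_bound k (Store A i a) = acost i + acost a + 1"
| "time_bound k (Seq P Q) = time_bound k P + time_bound k Q + 1"
| "time_bound k (If b P Q) = bcost b + time_bound k P + time_bound k Q + 1"
| "time_bound k (While b P) = (bcost b + time_bound k P + 1) * (k + 1)"

fun loop_free :: "com \<Rightarrow> bool" where
  "loop_free (Seq P Q) \<longleftrightarrow> loop_free P \<and> loop_free Q"
| "loop_free (If b P Q) \<longleftrightarrow> loop_free P \<and> loop_free Q"
| "loop_free (While b P) \<longleftrightarrow> False"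
| "loop_free _ \<longleftrightarrow> True"

fun no_nested_loops :: "com \<Rightarrow> bool" where
  "no_nested_loops (Seq P Q) \<longleftrightarrow> no_nested_loops P \<and> no_nested_loops Q"
| "no_nested_loops (If b P Q) \<longleftrightarrow> no_nested_loops P \<and> no_nested_loops Q"
| "no_nested_loops (While b P) \<longleftrightarrow> loop_free P"
| "no_nested_loops _ \<longleftrightarrow> True"

lemma time_bound_loop_free: "loop_free P \<Longrightarrow> time_bound k P = time_bound 0 P"
  by (induction P) auto

text \<open>A body without loops has a bound independent of \<open>k\<close>, so each loop
  contributes one factor \<open>k + 1\<close> and these factors never multiply.\<close>

lemma time_bound_linear:
  "no_nested_loops P \<Longrightarrow> time_bound k P \<le> time_bound 0 P * (k + 1)"
proof (induction P)
  case (While b P)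
  then show ?case
    using time_bound_loop_free[of P k] by simp
qed (simp_all add: algebra_simps)

fun assigned_scalars :: "com \<Rightarrow> string set" where
  "assigned_scalars (Assign x a) = {x}"
| "assigned_scalars (Seq P Q) = assigned_scalars P \<union> assigned_scalars Q"
| "assigned_scalars (If b P Q) = assigned_scalars P \<union> assigned_scalars Q"
| "assigned_scalars (While b P) = assigned_scalars P"
| "assigned_scalars _ = {}"

fun assigned_arrays :: "com \<Rightarrow> string set" where
  "assigned_arrays (Store A i a) = {A}"
| "assigned_arrays (Seq P Q) = assigned_arrays P \<union> assigned_arrays Q"
| "assigned_arrays (If b P Q) = assigned_arrays P \<union> assigned_arrays Q"
| "assigned_arrays (While b P) = assigned_arrays P"
| "assigned_arrays _ = {}"

definition frame :: "com \<Rightarrow> state \<Rightarrow> state \<Rightarrow> bool" where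
  "frame P s s' \<longleftrightarrow> (\<forall>x. x \<notin> assigned_scalars P \<longrightarrow> scalar s' x = scalar s x) \<and>
     (\<forall>A. A \<notin> assigned_arrays P \<longrightarrow> array s' A = array s A)"

text \<open>Lets invariants and postconditions omit inputs and earlier tables that a program never
  writes.\<close>

lemma exec_frame: "exec w P s t s' \<Longrightarrow> frame P s s'"
  by (induction rule: exec.induct) (auto simp: frame_def set_scalar_def set_array_def)

text \<open>Total correctness with time measured against the syntactic \<open>time_bound\<close>, so
  that concrete programs need no step counting.\<close>

definition runs :: "nat \<Rightarrow> nat \<Rightarrow> com \<Rightarrow> state \<Rightarrow> (state \<Rightarrow> bool) \<Rightarrow> bool" where
  "runs w k P s Q \<longleftrightarrow> (\<exists>t s'. exec w P s t s' \<and> t \<le> time_bound k P \<and> Q s')"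

lemma runs_Skip: "Q s \<Longrightarrow> runs w k Skip s Q"
  unfolding runs_def by (fastforce intro: exec.Skip)

lemma runs_Assign: "Q (set_scalar x (aval w a s) s) \<Longrightarrow> runs w k (Assign x a) s Q"
  unfolding runs_def by (fastforce intro: exec.Assign)

lemma runs_Store: "Q (set_array A (aval w i s) (aval w a s) s) \<Longrightarrow> runs w k (Store A i a) s Q"
  unfolding runs_def by (fastforce intro: exec.Store)

text \<open>\<open>Q\<close> may speak only of what \<open>P\<close> computes; everything untouched
  reaches \<open>P'\<close> through the frame.\<close>

lemma runs_Seq_frame:
  assumes "runs w k P s Q" and "\<And>s'. Q s' \<Longrightarrow> frame P s s' \<Longrightarrow> runs w k P' s' R"
  shows "runs w k (Seq P P') s R"
proof -
  obtain t s' where *: "exec w P s t s'" "t \<le> time_bound k P" "Q s'"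
    using assms(1) by (auto simp: runs_def)
  obtain u s'' where "exec w P' s' u s''" "u \<le> time_bound k P'" "R s''"
    using assms(2)[OF *(3) exec_frame[OF *(1)]] by (auto simp: runs_def)
  with * show ?thesis
    unfolding runs_def by (intro exI[of _ "t + u + 1"] exI[of _ s'']) (use * in \<open>auto intro: exec.Seq[simplified]\<close>)
qed

lemma runs_Seq: "runs w k P s (\<lambda>s'. runs w k P' s' R) \<Longrightarrow> runs w k (Seq P P') s R"
  by (rule runs_Seq_frame)

lemma runs_If:
  assumes "bval w b s \<Longrightarrow> runs w k P s R" and "\<not> bval w b s \<Longrightarrow> runs w k P' s R"
  shows "runs w k (If b P P') s R"
proof (cases "bval w b s")
  case True
  then obtain t s' where "exec w P s t s'" "t \<le> time_bound k P" "R s'"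
    using assms(1) by (auto simp: runs_def)
  with True show ?thesis
    unfolding runs_def
    by (intro exI[of _ "bcost b + t + 1"] exI[of _ s']) (auto intro: exec.IfTrue[simplified])
next
  case False
  then obtain t s' where "exec w P' s t s'" "t \<le> time_bound k P'" "R s'"
    using assms(2) by (auto simp: runs_def)
  with False show ?thesis
    unfolding runs_def
    by (intro exI[of _ "bcost b + t + 1"] exI[of _ s']) (auto intro: exec.IfFalse[simplified])
qed

text \<open>The potential falls in every iteration, so its initial value bounds their number. It may
  be an amortised measure instead of a counter.\<close>

lemma runs_While:
  assumes inv: "I s" and bound: "pot s \<le> k"
    and step: "\<And>s'. I s' \<Longrightarrow> frame P s s' \<Longrightarrow> bval w b s' \<Longrightarrow>
      runs w k P s' (\<lambda>s''. I s'' \<and> pot s'' < pot s')"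
    and post: "\<And>s'. I s' \<Longrightarrow> frame P s s' \<Longrightarrow> \<not> bval w b s' \<Longrightarrow> Q s'"
  shows "runs w k (While b P) s Q"
proof -
  let ?C = "bcost b + time_bound k P + 1"
  \<comment> \<open>Induction on the potential; the \<open>+ 1\<close> pays for the final failing
    test.\<close>
  have "\<exists>t s''. exec w (While b P) s' t s'' \<and> t \<le> ?C * (pot s' + 1) \<and> Q s''"
    if "I s'" "frame P s s'" for s'
    using that
  proof (induction "pot s'" arbitrary: s' rule: less_induct)
    case less
    show ?case
    proof (cases "bval w b s'")
      case True
      obtain t s1 where s1: "exec w P s' t s1" "t \<le> time_bound k P" "I s1" "pot s1 < pot s'"
        using step[OF less.prems True] by (auto simp: runs_def)
      have "frame P s s1"
        using less.prems(2) exec_frame[OF s1(1)] by (simp add: frame_def)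
      then obtain u s2 where s2: "exec w (While b P) s1 u s2" "u \<le> ?C * (pot s1 + 1)" "Q s2"
        using less.hyps[OF s1(4,3)] by blast
      have "?C * (pot s1 + 1) \<le> ?C * pot s'"
        using s1(4) by (intro mult_le_mono) auto
      then have "bcost b + t + u + 1 \<le> ?C * (pot s' + 1)"
        using s1(2) s2(2) by simp
      then show ?thesis
        using exec.WhileTrue[OF True s1(1) s2(1)] s2(3) by blast
    next
      case False
      then show ?thesis
        using exec.WhileFalse[OF False, of P] post[OF less.prems False]
        by (intro exI[of _ "bcost b + 1"] exI[of _ s']) simp
    qed
  qed
  moreover have "frame P s s"
    by (simp add: frame_def)
  moreover have "?C * (pot s + 1) \<le> time_bound k (While b P)"
    unfolding time_bound.simps using bound by (intro mult_le_mono) simp_all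
  ultimately show ?thesis
    using inv unfolding runs_def by (meson order_trans)
qed

lemmas runs_intros = runs_Skip runs_Assign runs_Store runs_Seq runs_If

lemma scalar_set_scalar [simp]: "scalar (set_scalar x k s) = (scalar s)(x := k)"
  and array_set_scalar [simp]: "array (set_scalar x k s) = array s"
  and scalar_set_array [simp]: "scalar (set_array A i k s) = scalar s"
  and array_set_array [simp]: "array (set_array A i k s) = (array s)(A := (array s A)(i := k))"
  by (simp_all add: set_scalar_def set_array_def)

subsection \<open>The algorithm\<close>

definition index_vertices :: com where
  "index_vertices =
     While (Less (Var ''i'') (Var ''n''))
       (Seq (Store ''pos'' (Elem ''vertex'' (Var ''i'')) (Plus (Var ''i'') (Lit 1)))
            (Assign ''i'' (Plus (Var ''i'') (Lit 1))))"

definition record_edge :: "string \<Rightarrow> aexp \<Rightarrow> aexp \<Rightarrow> com" where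
  "record_edge A x y = If (Less (Elem A x) y) (Store A x y) Skip"

definition read_edges :: com where
  "read_edges =
     While (Less (Var ''j'') (Var ''m''))
       (Seq (Assign ''u'' (Elem ''pos'' (Elem ''end1'' (Var ''j''))))
       (Seq (Assign ''v'' (Elem ''pos'' (Elem ''end2'' (Var ''j''))))
       (Seq (If (Less (Var ''v'') (Var ''u''))
               (Seq (Assign ''h'' (Var ''u''))
               (Seq (Assign ''u'' (Var ''v''))
                    (Assign ''v'' (Var ''h''))))
               Skip)
       (Seq (record_edge ''far'' (Var ''u'') (Var ''v''))
       (Seq (record_edge ''mfar'' (Minus (Plus (Var ''n'') (Lit 1)) (Var ''v''))
                                  (Minus (Plus (Var ''n'') (Lit 1)) (Var ''u'')))
            (Assign ''j'' (Plus (Var ''j'') (Lit 1))))))))"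

text \<open>Following a link and finishing a cell are two branches of one loop. This avoids nested
  loops, and the amortisation is left to the potential.\<close>

definition compute_covers :: "string \<Rightarrow> string \<Rightarrow> com" where
  "compute_covers A B =
     Seq (Assign ''b'' (Lit 1))
     (Seq (Assign ''c'' (Lit 0))
       (While (Less (Var ''b'') (Plus (Var ''n'') (Lit 1)))
         (If (And (Less (Lit 0) (Var ''c'')) (Less (Elem A (Var ''c'')) (Var ''b'')))
           (Assign ''c'' (Elem B (Var ''c'')))
           (Seq (Store B (Var ''b'') (Var ''c''))
           (Seq (Assign ''c'' (Var ''b''))
                (Assign ''b'' (Plus (Var ''b'') (Lit 1))))))))"

definition compute_starts :: com where
  "compute_starts =
     Seq (Assign ''b'' (Lit 1))
     (Seq (Assign ''c'' (Lit 0))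
       (While (Less (Var ''b'') (Plus (Var ''n'') (Lit 1)))
         (Seq (Store ''start'' (Var ''b'') (Var ''c''))
         (Seq (If (Less (Lit 0) (Elem ''far'' (Var ''b''))) (Assign ''c'' (Var ''b'')) Skip)
              (Assign ''b'' (Plus (Var ''b'') (Lit 1)))))))"

text \<open>The two alternatives of the test are joined by De Morgan, as there is no disjunction
  among the boolean expressions.\<close>

definition search_split :: com where
  "search_split =
     Seq (Assign ''a'' (Lit 1))
     (Seq (Assign ''r'' (Lit 0))
       (While (Less (Var ''a'') (Plus (Var ''n'') (Lit 1)))
         (Seq (If (Less (Var ''r'') (Elem ''far'' (Var ''a'')))
                (Assign ''r'' (Elem ''far'' (Var ''a''))) Skip)
         (Seq (Assign ''p'' (Minus (Plus (Var ''n'') (Lit 1))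
                (Elem ''mcover'' (Minus (Plus (Var ''n'') (Lit 1)) (Var ''a'')))))
         (Seq (If (And (Less (Var ''p'') (Var ''r''))
                    (Not (And (Not (Less (Var ''a'') (Elem ''cover'' (Plus (Var ''p'') (Lit 1)))))
                              (Not (Less (Var ''p'') (Elem ''start'' (Var ''r'')))))))
                (Assign ''answer'' (Lit 1)) Skip)
              (Assign ''a'' (Plus (Var ''a'') (Lit 1))))))))"

definition K3_program :: com where
  "K3_program =
     If (Less (Plus (Var ''n'') (Var ''n'')) (Var ''m''))
       (Assign ''answer'' (Lit 1))
       (Seq index_vertices
       (Seq read_edges
       (Seq (compute_covers ''far'' ''cover'')
       (Seq (compute_covers ''mfar'' ''mcover'')
       (Seq compute_starts
            search_split)))))"

section \<open>Arithmetic without overflow and correctness of the phases\<close>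

lemma aval_Plus_1:
  "Suc (aval w a s) < 2 ^ w \<Longrightarrow> aval w (Plus a (Lit (Suc 0))) s = Suc (aval w a s)"
  by (cases w) simp_all

lemma aval_1: "Suc 0 < 2 ^ w \<Longrightarrow> aval w (Lit (Suc 0)) s = Suc 0"
  by (cases w) simp_all

declare aval.simps(1,4) [simp del]

declare aval_Plus_1 [simp] aval_1 [simp]

lemma aval_0 [simp]: "aval w (Lit 0) s = 0"
  by (simp add: aval.simps)

text \<open>Distinct vertices use distinct cells, so no store destroys the position of an earlier
  vertex.\<close>

lemma runs_index_vertices:
  assumes "scalar s ''n'' = length vs" "array s ''vertex'' = array_of vs" "scalar s ''i'' = 0"
    and "distinct vs" "length vs < 2 ^ w" "length vs \<le> k"
  shows "runs w k index_vertices s (\<lambda>s'. \<forall>i<length vs. array s' ''pos'' (vs ! i) = Suc i)"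
  unfolding index_vertices_def
  by (rule runs_While[where I = "\<lambda>s. scalar s ''i'' \<le> length vs \<and>
        (\<forall>i<scalar s ''i''. array s ''pos'' (vs ! i) = Suc i)" and
        pot = "\<lambda>s. length vs - scalar s ''i''"])
    (use assms in \<open>auto simp: frame_def array_of_def less_Suc_eq nth_eq_iff_index_eq
      intro!: runs_intros\<close>)

lemma runs_record_edge:
  assumes "finite S" "array s A = farthest S" "aval w x s = u" "aval w y s = v"
    and "\<And>s'. scalar s' = scalar s \<Longrightarrow> array s' = (array s)(A := farthest (insert (u, v) S)) \<Longrightarrow> Q s'"
  shows "runs w k (record_edge A x y) s Q"
proof -
  have "(array s)(A := farthest (insert (u, v) S)) =
      (if farthest S u < v then (array s)(A := (array s A)(u := v)) else array s)"
    using assms(1,2) by (auto simp: farthest_insert fun_eq_iff max_def)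
  then show ?thesis
    unfolding record_edge_def using assms by (intro runs_intros) (auto split: if_splits)
qed

lemma runs_read_edges:
  assumes "scalar s ''n'' = n" "scalar s ''m'' = length es" "scalar s ''j'' = 0"
    and "array s ''end1'' = array_of (map fst es)" "array s ''end2'' = array_of (map snd es)"
    and "array s ''far'' = (\<lambda>_. 0)" "array s ''mfar'' = (\<lambda>_. 0)"
    and "n + 1 < 2 ^ w" "length es < 2 ^ w" "length es \<le> k"
  defines "S \<equiv> position_edge (array s ''pos'') ` set es"
  shows "runs w k read_edges s (\<lambda>s'. array s' ''far'' = farthest S \<and>
     array s' ''mfar'' = farthest (mirror n ` S))"
proof -
  \<comment> \<open>The invariant describes the tables for the first \<open>j\<close> list entries;
    the initial zero arrays are the tables of the empty edge set.\<close>
  define prefix where "prefix j = position_edge (array s ''pos'') ` set (take j es)" for j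
  define I where "I s \<longleftrightarrow> scalar s ''j'' \<le> length es \<and>
    array s ''far'' = farthest (prefix (scalar s ''j'')) \<and>
    array s ''mfar'' = farthest (mirror n ` prefix (scalar s ''j''))" for s :: state
  have S_Suc: "prefix (Suc j) = insert (position_edge (array s ''pos'') (es ! j)) (prefix j)"
    if "j < length es" for j
    using that by (simp add: prefix_def take_Suc_conv_app_nth)
  have fin: "finite (prefix j)" for j
    by (simp add: prefix_def)
  show ?thesis
    unfolding read_edges_def
  proof (rule runs_While[where I = I and pot = "\<lambda>s. length es - scalar s ''j''"], goal_cases)
    case 1
    then show ?case
      using assms by (simp add: I_def prefix_def farthest_empty fun_eq_iff)
  next
    case 2
    then show ?case
      using assms by simp
  next
    case (3 s')
    define j where "j = scalar s' ''j''"
    have j: "j < length es"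
      using 3 assms by (simp add: frame_def record_edge_def j_def)
    obtain x y where xy: "es ! j = (x, y)"
      by fastforce
    let ?u = "min (array s ''pos'' x) (array s ''pos'' y)"
    let ?v = "max (array s ''pos'' x) (array s ''pos'' y)"
    have S': "prefix (Suc j) = insert (?u, ?v) (prefix j)"
      using S_Suc[OF j] xy by (simp add: position_edge_def)
    have m: "mirror n ` prefix (Suc j) = insert (n + 1 - ?v, n + 1 - ?u) (mirror n ` prefix j)"
      by (simp add: S' mirror_def)
    have I: "array s' ''far'' = farthest (prefix j)" "array s' ''mfar'' = farthest (mirror n ` prefix j)"
      using 3(1) by (simp_all add: I_def j_def)
    have fr: "array s' ''end1'' j = x" "array s' ''end2'' j = y" "array s' ''pos'' = array s ''pos''"
      "scalar s' ''n'' = n"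
      using 3(2) assms j xy by (simp_all add: frame_def record_edge_def array_of_def)
    have goal: "I t \<and> length es - scalar t ''j'' < length es - scalar s' ''j''"
      if "scalar t ''j'' = Suc j" "array t ''far'' = farthest (prefix (Suc j))"
        "array t ''mfar'' = farthest (mirror n ` prefix (Suc j))" for t
      using that j by (simp add: I_def j_def)
    \<comment> \<open>With or without the swap, \<open>u\<close> and \<open>v\<close> now hold the
      smaller and the larger position, so the rest of the body is treated once.\<close>
    have edges: "runs w k
       (Seq (record_edge ''far'' (Var ''u'') (Var ''v''))
       (Seq (record_edge ''mfar'' (Minus (Plus (Var ''n'') (Lit 1)) (Var ''v''))
                                  (Minus (Plus (Var ''n'') (Lit 1)) (Var ''u'')))
            (Assign ''j'' (Plus (Var ''j'') (Lit 1))))) t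
       (\<lambda>t. I t \<and> length es - scalar t ''j'' < length es - scalar s' ''j'')"
      if t: "array t = array s'" "scalar t ''n'' = n" "scalar t ''j'' = j"
        "scalar t ''u'' = ?u" "scalar t ''v'' = ?v" for t
      apply (rule runs_Seq)
      apply (rule runs_record_edge[where S = "prefix j" and u = ?u and v = ?v])
          apply (simp_all add: t I fin)
      apply (rule runs_Seq)
      apply (rule runs_record_edge[where S = "mirror n ` prefix j" and u = "n + 1 - ?v" and v = "n + 1 - ?u"])
          apply (use assms(8) in \<open>simp_all add: t I fin\<close>)
      apply (intro runs_Assign goal)
        apply (use assms(9) j in \<open>simp_all add: t m flip: S'\<close>)
      done
    show ?case
    proof (rule runs_Seq, rule runs_Assign, rule runs_Seq, rule runs_Assign,
        rule runs_Seq, rule runs_If, goal_cases)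
      case 1
      show ?case
        by (rule runs_Seq, rule runs_Assign, rule runs_Seq, rule runs_Assign,
            rule runs_Assign, rule edges) (use 1 fr in \<open>auto simp flip: j_def\<close>)
    next
      case 2
      show ?case
        by (rule runs_Skip, rule edges) (use 2 fr in \<open>auto simp flip: j_def\<close>)
    qed
  next
    case (4 s')
    then have "scalar s' ''j'' = length es"
      using assms by (simp add: I_def frame_def record_edge_def)
    with 4 assms show ?case
      by (simp add: I_def prefix_def S_def)
  qed
qed

function cover_depth :: "(nat \<Rightarrow> nat) \<Rightarrow> nat \<Rightarrow> nat" where
  "cover_depth f x = (if x = 0 then 0 else Suc (cover_depth f (latest_cover f x)))"
  by auto
termination
  by (relation "measure snd") (auto simp: latest_cover_less)

declare cover_depth.simps [simp del]

text \<open>A position strictly between \<open>latest_cover f c\<close> and \<open>c\<close> has \<open>f\<close>-value below \<open>c\<close>, so it cannot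
  cover a later position and may be jumped over. The length of the remaining jump chain is the
  potential for the amortised analysis.\<close>

lemma runs_compute_covers:
  assumes "A \<noteq> B" "scalar s ''n'' = n" "array s A = f" "n + 1 < 2 ^ w" "2 * n \<le> k"
  shows "runs w k (compute_covers A B) s
    (\<lambda>s'. \<forall>b. 1 \<le> b \<and> b \<le> n \<longrightarrow> array s' B b = latest_cover f b)"
proof -
  \<comment> \<open>The last conjunct says that no position strictly between \<open>c\<close> and
    \<open>b\<close> covers \<open>b\<close>, so \<open>c\<close> is the best remaining
    candidate.\<close>
  define I where "I s \<longleftrightarrow> 1 \<le> scalar s ''b'' \<and> scalar s ''b'' \<le> n + 1 \<and>
    scalar s ''c'' < scalar s ''b'' \<and>
    (\<forall>b. 1 \<le> b \<and> b < scalar s ''b'' \<longrightarrow> array s B b = latest_cover f b) \<and>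
    (\<forall>x. scalar s ''c'' < x \<and> x < scalar s ''b'' \<longrightarrow> f x < scalar s ''b'')" for s :: state
  \<comment> \<open>Advancing \<open>b\<close> lowers the first term by 2 and lengthens the chain by
    1; a jump shortens the chain by 1. The initial value is \<open>2 * n\<close>.\<close>
  define potential where
    "potential s = 2 * (n + 1 - scalar s ''b'') + cover_depth f (scalar s ''c'')" for s :: state
  have loop: "runs w k (While (Less (Var ''b'') (Plus (Var ''n'') (Lit 1)))
         (If (And (Less (Lit 0) (Var ''c'')) (Less (Elem A (Var ''c'')) (Var ''b'')))
           (Assign ''c'' (Elem B (Var ''c'')))
           (Seq (Store B (Var ''b'') (Var ''c''))
           (Seq (Assign ''c'' (Var ''b''))
                (Assign ''b'' (Plus (Var ''b'') (Lit 1))))))) s1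
     (\<lambda>s'. \<forall>b. 1 \<le> b \<and> b \<le> n \<longrightarrow> array s' B b = latest_cover f b)"
    if s1: "scalar s1 ''n'' = n" "array s1 A = f" "scalar s1 ''b'' = 1" "scalar s1 ''c'' = 0" for s1
  proof (rule runs_While[where I = I and pot = potential], goal_cases)
    case 1
    then show ?case
      using s1 by (simp add: I_def)
  next
    case 2
    then show ?case
      using s1 assms by (simp add: potential_def cover_depth.simps)
  next
    case (3 s')
    define b where "b = scalar s' ''b''"
    define c where "c = scalar s' ''c''"
    have fr: "scalar s' ''n'' = n" "array s' A = f"
      using 3(2) s1 assms by (simp_all add: frame_def)
    have I: "1 \<le> b" "c < b" "\<And>x. 1 \<le> x \<Longrightarrow> x < b \<Longrightarrow> array s' B x = latest_cover f x"
      "\<And>x. c < x \<Longrightarrow> x < b \<Longrightarrow> f x < b"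
      using 3(1) by (auto simp: I_def b_def c_def)
    have bn: "b \<le> n"
      using 3(3) fr assms by (simp add: b_def)
    show ?case
    proof (rule runs_If, goal_cases)
      case 1
      then have c: "0 < c" "f c < b"
        using fr by (simp_all add: b_def c_def)
      have less: "latest_cover f c < c"
        using c by (intro latest_cover_less)
      \<comment> \<open>Positions below \<open>c\<close> are excluded by maximality of
        \<open>latest_cover f c\<close>, \<open>c\<close> itself by the test just made, and later
        ones by the invariant.\<close>
      have "f x < b" if "latest_cover f c < x" "x < b" for x
      proof (cases "x < c")
        case True
        then have "f x < c"
          using that(1) max0_ge[of "{x. x < c \<and> c \<le> f x}" x] by (force simp: latest_cover_def)
        then show ?thesis
          using I(2) by simp
      next
        case False
        then show ?thesis
          using that(2) I(4) c by (cases "x = c") auto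
      qed
      moreover have "cover_depth f c = Suc (cover_depth f (latest_cover f c))"
        using c by (simp add: cover_depth.simps[of f c])
      ultimately show ?case
        using less I bn c
        by (intro runs_Assign) (simp add: I_def potential_def flip: b_def c_def)
    next
      case 2
      then have c: "c = 0 \<or> b \<le> f c"
        using fr by (auto simp: b_def c_def)
      \<comment> \<open>If the chain is exhausted, \<open>c = 0\<close> is exactly the default of
        \<open>max0\<close>.\<close>
      have M: "latest_cover f b = c"
        unfolding latest_cover_def using c I by (intro max0_eqI) (auto simp: not_less[symmetric])
      have "cover_depth f b = Suc (cover_depth f c)"
        using I by (simp add: cover_depth.simps[of f b] M)
      then show ?case
        using I bn M assms
        by (intro runs_intros) (auto simp: I_def potential_def less_Suc_eq simp flip: b_def c_def)
    qed
  next
    case (4 s')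
    then have "scalar s' ''n'' = n"
      using s1 by (simp add: frame_def)
    then show ?case
      using 4 assms by (auto simp: I_def)
  qed
  show ?thesis
    unfolding compute_covers_def
    by (intro runs_Seq runs_Assign loop) (use assms in simp_all)
qed

lemma runs_compute_starts:
  assumes "scalar s ''n'' = n" "array s ''far'' = f" "n + 1 < 2 ^ w" "n \<le> k" "f 0 = 0"
  shows "runs w k compute_starts s
    (\<lambda>s'. \<forall>b. 1 \<le> b \<and> b \<le> n \<longrightarrow> array s' ''start'' b = latest_start f b)"
proof -
  have start1: "latest_start f (Suc 0) = 0"
    using assms by (simp add: latest_start_Suc) (simp add: latest_start_def)
  define I where "I s \<longleftrightarrow> 1 \<le> scalar s ''b'' \<and> scalar s ''b'' \<le> n + 1 \<and>
    scalar s ''c'' = latest_start f (scalar s ''b'') \<and>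
    (\<forall>b. 1 \<le> b \<and> b < scalar s ''b'' \<longrightarrow> array s ''start'' b = latest_start f b)" for s :: state
  show ?thesis
    unfolding compute_starts_def
    apply (intro runs_Seq runs_Assign)
  proof (rule runs_While[where I = I and pot = "\<lambda>s. n + 1 - scalar s ''b''"], goal_cases)
    case 1
    then show ?case
      using assms start1 by (simp add: I_def)
  next
    case 2
    then show ?case
      using assms by simp
  next
    case (3 s')
    define b where "b = scalar s' ''b''"
    have fr: "scalar s' ''n'' = n" "array s' ''far'' = f"
      using 3(2) assms by (simp_all add: frame_def)
    have b: "1 \<le> b" "b \<le> n"
      using 3(1,3) fr assms by (simp_all add: I_def b_def)
    have I: "scalar s' ''c'' = latest_start f b"
      "\<And>x. 1 \<le> x \<Longrightarrow> x < b \<Longrightarrow> array s' ''start'' x = latest_start f x"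
      using 3(1) by (simp_all add: I_def b_def)
    show ?case
      by (intro runs_intros)
        (use I b fr assms(3) in \<open>simp_all add: I_def latest_start_Suc less_Suc_eq flip: b_def\<close>)
  next
    case (4 s')
    then have "scalar s' ''n'' = n"
      using assms by (simp add: frame_def)
    then show ?case
      using 4 assms by (simp add: I_def)
  qed
qed

lemma runs_search_split:
  assumes S: "position_edges n S"
  defines "f \<equiv> farthest S"
  assumes "scalar s ''n'' = n" "scalar s ''answer'' = 0" "n + 1 < 2 ^ w" "n \<le> k"
    and "array s ''far'' = f"
    and "\<forall>b. 1 \<le> b \<and> b \<le> n \<longrightarrow> array s ''cover'' b = latest_cover f b"
    and "\<forall>b. 1 \<le> b \<and> b \<le> n \<longrightarrow> array s ''mcover'' b = latest_cover (farthest (mirror n ` S)) b"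
    and "\<forall>b. 1 \<le> b \<and> b \<le> n \<longrightarrow> array s ''start'' b = latest_start f b"
  shows "runs w k search_split s
    (\<lambda>s'. scalar s' ''answer'' = (if K3_positions S then 1 else 0))"
proof -
  define split_at where "split_at a \<longleftrightarrow> next_end n S a < prefix_max f a \<and>
    (a < latest_cover f (next_end n S a + 1) \<or> next_end n S a < latest_start f (prefix_max f a))" for a
  \<comment> \<open>Position \<open>a\<close> is still to be processed, hence \<open>a - 1\<close>;
    the initial \<open>r = 0\<close> agrees with \<open>prefix_max f 0\<close>.\<close>
  define I where "I s \<longleftrightarrow> 1 \<le> scalar s ''a'' \<and> scalar s ''a'' \<le> n + 1 \<and>
    scalar s ''r'' = prefix_max f (scalar s ''a'' - 1) \<and>
    scalar s ''answer'' = (if \<exists>a. 1 \<le> a \<and> a < scalar s ''a'' \<and> split_at a then 1 else 0)" for s :: state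
  have R: "prefix_max f a \<le> n" for a
    using less_prefix_max_iff[of n f a] farthest_le[OF S] by (auto simp: f_def not_le[symmetric])
  have R0: "prefix_max f 0 = 0"
    using farthest_0[OF S] by (simp add: prefix_max_def max0_insert f_def)
  have final: "K3_positions S \<longleftrightarrow> (\<exists>a. 1 \<le> a \<and> a < n + 1 \<and> split_at a)"
    using K3_positions_iff[OF S] by (auto simp: split_at_def f_def less_Suc_eq_le)
  show ?thesis
    unfolding search_split_def
    apply (intro runs_Seq runs_Assign)
  proof (rule runs_While[where I = I and pot = "\<lambda>s. n + 1 - scalar s ''a''"], goal_cases)
    case 1
    then show ?case
      using assms R0 by (auto simp: I_def)
  next
    case 2
    then show ?case
      using assms by simp
  next
    case (3 s')
    define a where "a = scalar s' ''a''"
    have fr: "scalar s' ''n'' = n" "array s' = array s"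
      using 3(2) assms by (simp_all add: frame_def fun_eq_iff)
    have a: "1 \<le> a" "a \<le> n"
      using 3(1,3) fr assms by (simp_all add: I_def a_def)
    then obtain a' where a': "a = Suc a'"
      by (cases a) auto
    have r: "scalar s' ''r'' = prefix_max f a'"
      using 3(1) a' by (simp add: I_def flip: a_def)
    \<comment> \<open>For \<open>a\<close> between 1 and \<open>n\<close> the index
      \<open>n + 1 - a\<close> also lies between 1 and \<open>n\<close>, where the table is
      known.\<close>
    have p: "n + 1 - array s ''mcover'' (n + 1 - a) = next_end n S a"
      unfolding next_end_def using a by (subst assms(9)[rule_format]) auto
    have rest: "runs w k
         (Seq (Assign ''p'' (Minus (Plus (Var ''n'') (Lit 1))
                (Elem ''mcover'' (Minus (Plus (Var ''n'') (Lit 1)) (Var ''a'')))))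
         (Seq (If (And (Less (Var ''p'') (Var ''r''))
                    (Not (And (Not (Less (Var ''a'') (Elem ''cover'' (Plus (Var ''p'') (Lit 1)))))
                              (Not (Less (Var ''p'') (Elem ''start'' (Var ''r'')))))))
                (Assign ''answer'' (Lit 1)) Skip)
              (Assign ''a'' (Plus (Var ''a'') (Lit 1))))) t
       (\<lambda>t. I t \<and> n + 1 - scalar t ''a'' < n + 1 - scalar s' ''a'')"
      if t: "array t = array s" "scalar t ''n'' = n" "scalar t ''a'' = a"
        "scalar t ''r'' = prefix_max f a" "scalar t ''answer'' = scalar s' ''answer''" for t
    proof -
      let ?t = "set_scalar ''p'' (next_end n S a) t"
      \<comment> \<open>If \<open>p < r\<close>, then \<open>r \<le> n\<close> keeps the indices
        \<open>p + 1\<close> and \<open>r\<close> inside the tables and prevents overflow; otherwise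
        the first conjunct is false whatever the other reads return.\<close>
      have test: "bval w (And (Less (Var ''p'') (Var ''r''))
                    (Not (And (Not (Less (Var ''a'') (Elem ''cover'' (Plus (Var ''p'') (Lit 1)))))
                              (Not (Less (Var ''p'') (Elem ''start'' (Var ''r''))))))) ?t
          \<longleftrightarrow> split_at a"
        using t R[of a] assms by (auto simp: split_at_def)
      have pt: "aval w (Minus (Plus (Var ''n'') (Lit 1))
                (Elem ''mcover'' (Minus (Plus (Var ''n'') (Lit 1)) (Var ''a'')))) t = next_end n S a"
        using t assms p by simp
      have answer: "scalar s' ''answer'' = (if \<exists>x. 1 \<le> x \<and> x < a \<and> split_at x then 1 else 0)"
        using 3(1) by (simp add: I_def a_def)
      show ?thesis
        apply (rule runs_Seq, rule runs_Assign, unfold pt, rule runs_Seq, rule runs_If;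
            unfold test; intro runs_intros)
        using t a assms answer by (auto simp: I_def less_Suc_eq simp flip: a_def)
    qed
    have far: "array s' ''far'' = f"
      using fr assms by simp
    show ?case
    proof (rule runs_Seq, rule runs_If, goal_cases)
      case 1
      show ?case
        by (rule runs_Assign, rule rest)
          (use 1 fr r a' far prefix_max_Suc[of f a'] in \<open>simp_all flip: a_def\<close>)
    next
      case 2
      show ?case
        by (rule runs_Skip, rule rest)
          (use 2 fr r a' far prefix_max_Suc[of f a'] in \<open>simp_all flip: a_def\<close>)
    qed
  next
    case (4 s')
    then have "scalar s' ''n'' = n"
      using assms by (simp add: frame_def)
    then have "scalar s' ''a'' = n + 1"
      using 4 assms by (simp add: I_def)
    then show ?case
      using 4(1) final by (simp add: I_def)
  qed
qed

section \<open>Assembly of the phases and the linear time bound\<close>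

lemma runs_K3_program:
  assumes graph: "ordered_graph V E r" and repr: "explicit_representation V E r vs es"
    and word: "word_length_suffices 2 w vs es"
  shows "runs w (2 * length vs) K3_program (initial_state vs es)
    (\<lambda>s. scalar s ''answer'' = (if K3_interval_minor V E r then 1 else 0))"
proof -
  let ?n = "length vs" and ?s = "initial_state vs es"
  \<comment> \<open>The factor 2 keeps \<open>n + n\<close> in the opening test from wrapping
    around.\<close>
  have W: "2 * (?n + length es + 1) < 2 ^ w"
    using word by (simp add: word_length_suffices_def)
  have dist: "distinct vs"
    using repr by (simp add: explicit_representation_def)
  show ?thesis
    unfolding K3_program_def
  proof (rule runs_If, goal_cases)
    case 1
    then have many: "2 * ?n < length es"
      using W by (simp add: initial_state_def aval.simps)
    \<comment> \<open>In this branch no position array has been computed, so the positions are given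
      by description.\<close>
    define p where "p v = Suc (THE i. i < ?n \<and> vs ! i = v)" for v
    interpret represented_graph V E r vs es p
    proof (unfold_locales, fact graph, fact repr)
      fix i assume "i < ?n"
      then show "p (vs ! i) = Suc i"
        unfolding p_def using dist by (auto simp: nth_eq_iff_index_eq intro!: the_equality)
    qed
    have "K3_interval_minor V E r"
      using K3_positions_if_many_edges[OF position_edges_S] many
      by (simp add: K3_interval_minor_iff card_S)
    then show ?case
      using W by (intro runs_Assign) simp
  next
    case 2
    then have few: "length es \<le> 2 * ?n"
      using W by (simp add: initial_state_def aval.simps)
    show ?case
    proof (rule runs_Seq_frame, rule runs_index_vertices[where vs = vs], goal_cases)
      case (7 s1)
      define p where "p = array s1 ''pos''"
      interpret represented_graph V E r vs es p
        using graph repr 7(1) by unfold_locales (auto simp: p_def)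
      \<comment> \<open>The frames of successive phases are accumulated: each later phase must still
        find the input and the tables computed before it.\<close>
      note fr1 = 7(2)[unfolded frame_def index_vertices_def]
      show ?case
      proof (rule runs_Seq_frame, rule runs_read_edges[where n = ?n and es = es], goal_cases)
        case (11 s2)
        note far = 11(1)[folded p_def]
        note fr2 = fr1 11(2)[unfolded frame_def read_edges_def record_edge_def]
        show ?case
        proof (rule runs_Seq_frame, rule runs_compute_covers[where n = ?n and f = "farthest S"],
            goal_cases)
          case (6 s3)
          note fr3 = fr2 6(2)[unfolded frame_def compute_covers_def]
          note cover = 6(1)
          show ?case
          proof (rule runs_Seq_frame,
              rule runs_compute_covers[where n = ?n and f = "farthest (mirror ?n ` S)"], goal_cases)
            case (6 s4)
            note fr4 = fr3 6(2)[unfolded frame_def compute_covers_def]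
            note mcover = 6(1)
            show ?case
            proof (rule runs_Seq_frame,
                rule runs_compute_starts[where n = ?n and f = "farthest S"], goal_cases)
              case (6 s5)
              note fr5 = fr4 6(2)[unfolded frame_def compute_starts_def]
              show ?case
                unfolding K3_interval_minor_iff
                by (rule runs_search_split[OF position_edges_S])
                  (use W fr5 far cover mcover 6(1) in \<open>simp_all add: initial_state_def\<close>)
            next
              case 5
              show ?case
                using position_edges_S by (rule farthest_0)
            qed (use W fr4 far in \<open>simp_all add: initial_state_def\<close>)
          qed (use W fr3 far in \<open>simp_all add: initial_state_def\<close>)
        qed (use W fr2 far in \<open>simp_all add: initial_state_def\<close>)
      qed (use W fr1 few in \<open>simp_all add: initial_state_def\<close>)
    qed (use W dist in \<open>simp_all add: initial_state_def\<close>)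
  qed
qed

theorem theorem28:
  "\<exists>(P :: com) (c :: nat) (T :: nat \<Rightarrow> nat).
     (\<lambda>n. real (T n)) \<in> O(\<lambda>n. real n) \<and>
     (\<forall>V E r vs es w.
        ordered_graph V E r \<longrightarrow>
        explicit_representation V E r vs es \<longrightarrow>
        word_length_suffices c w vs es \<longrightarrow>
        (\<exists>t s. exec w P (initial_state vs es) t s \<and>
               t \<le> T (card V) \<and>
               scalar s ''answer'' = (if K3_interval_minor V E r then 1 else 0)))"
proof (rule exI[of _ K3_program], rule exI[of _ 2],
    rule exI[of _ "\<lambda>n. time_bound (2 * n) K3_program"], intro conjI allI impI)
  let ?K = "time_bound 0 K3_program"
  have simple: "no_nested_loops K3_program"
    by (simp add: K3_program_def index_vertices_def read_edges_def record_edge_def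
        compute_covers_def compute_starts_def search_split_def)
  \<comment> \<open>For positive \<open>n\<close>, the factor \<open>2 * n + 1\<close> is at most
    \<open>3 * n\<close>, whence the constant \<open>3 * ?K\<close>.\<close>
  have "real (time_bound (2 * n) K3_program) \<le> real (3 * ?K) * real n" if "1 \<le> n" for n
  proof -
    have "time_bound (2 * n) K3_program \<le> ?K * (2 * n + 1)"
      using time_bound_linear[OF simple] .
    also have "\<dots> \<le> ?K * (3 * n)"
      using that by (intro mult_le_mono) auto
    finally show ?thesis
      by (simp flip: of_nat_mult add: mult.assoc mult.left_commute)
  qed
  then show "(\<lambda>n. real (time_bound (2 * n) K3_program)) \<in> O(\<lambda>n. real n)"
    by (intro bigoI[of _ "real (3 * ?K)"] eventually_sequentiallyI[of 1]) simp
next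
  fix V E r vs es w
  assume *: "ordered_graph V E r" "explicit_representation V E r vs es"
    "word_length_suffices 2 w vs es"
  then have "card V = length vs"
    by (auto simp: explicit_representation_def distinct_card)
  then show "\<exists>t s. exec w K3_program (initial_state vs es) t s \<and>
      t \<le> time_bound (2 * card V) K3_program \<and>
      scalar s ''answer'' = (if K3_interval_minor V E r then 1 else 0)"
    using runs_K3_program[OF *] by (simp add: runs_def)
qed

end
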